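(* Let $q$ be a prime power, let $n$ and $m\ge3$ be positive integers, and let $I,J$ be nonnegative integers with $I<J<n$. Let $\alpha_1,\dots,\alpha_m\in\mathbb{F}_{q^n}^*$, $\mathbf{A}=(\alpha_1,\dots,\alpha_m)$, and $$U^{I,J}_{\mathbf{A}}:=\{(x_1,\dots,x_m,f_1(\underline{x}),\dots,f_m(\underline{x})) : x_1,\dots,x_m\in\mathbb{F}_{q^n}\}\subseteq\mathbb{F}_{q^n}^{2m},$$ where $f_i(\underline{x})=x_i^{q^I}+\alpha_{i+1}x_{i+1}^{q^J}$ for $i=1,\dots,m-1$ and $f_m(\underline{x})=x_m^{q^I}+\alpha_1x_1^{q^J}$. If $n\ge 2(mJ+J+1)$, then $U^{I,J}_{\mathbf{A}}$ is $(r,\frac{rn}{2}-1)_q$-evasive for every odd $r$ with $2\le r\le m$.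
   Context: For positive integers $h,r$, an $\mathbb{F}_q$-subspace $U\subseteq\mathbb{F}_{q^n}^k$ is $(h,r)_q$-evasive if $\dim_{\mathbb{F}_q}(U\cap H)\le r$ for every $\mathbb{F}_{q^n}$-subspace $H\subseteq\mathbb{F}_{q^n}^k$ with $\dim_{\mathbb{F}_{q^n}}H=h$. *)

theory Defs
  imports
    Complex_Main
    "HOL-Library.Cardinality"
    "HOL-Library.Function_Algebras"
    "HOL-Number_Theory.Prime_Powers"
begin

text \<open>
  The coordinate space \<open>F\<^sup>k\<close> is modelled by the functions \<open>nat \<Rightarrow> F\<close> that vanish outside the index
  range \<open>{1..k}\<close>. The extension \<open>\<F>\<^sub>q \<subseteq> \<F>\<^bsub>q^n\<^esub>\<close> is given by two finite field types and an
  embedding between them; a field embedding is automatically injective.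
\<close>

definition coord_space :: "nat \<Rightarrow> (nat \<Rightarrow> 'a::field) set" where
  "coord_space k = {v. \<forall>i. i \<notin> {1..k} \<longrightarrow> v i = 0}"

definition field_embedding :: "('k::field \<Rightarrow> 'a::field) \<Rightarrow> bool" where
  "field_embedding e \<longleftrightarrow>
     e 1 = 1 \<and> (\<forall>x y. e (x + y) = e x + e y) \<and> (\<forall>x y. e (x * y) = e x * e y)"

definition scale_via :: "('k::field \<Rightarrow> 'a::field) \<Rightarrow> 'k \<Rightarrow> (nat \<Rightarrow> 'a) \<Rightarrow> (nat \<Rightarrow> 'a)" where
  "scale_via e c v = (\<lambda>i. e c * v i)"

lemma vector_space_scale_via:
  assumes "field_embedding e"
  shows "vector_space (scale_via e)"
  using assms
  by unfold_locales (auto simp: scale_via_def field_embedding_def fun_eq_iff algebra_simps)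

lemma vector_space_scale_via_id: "vector_space (scale_via (id :: 'a::field \<Rightarrow> 'a))"
  by (rule vector_space_scale_via) (simp add: field_embedding_def)

text \<open>
  Evasiveness of \<open>U\<close> in \<open>F\<^sup>k\<close> with respect to the subfield \<open>range e\<close> of \<open>F\<close>. The bound \<open>s\<close> is real,
  so that half-integral bounds are meaningful.
\<close>

definition evasive ::
  "('k::field \<Rightarrow> 'a::field) \<Rightarrow> nat \<Rightarrow> nat \<Rightarrow> real \<Rightarrow> (nat \<Rightarrow> 'a) set \<Rightarrow> bool" where
  "evasive e k h s U \<longleftrightarrow>
     U \<subseteq> coord_space k \<and> module.subspace (scale_via e) U \<and>
     (\<forall>H. H \<subseteq> coord_space k \<longrightarrow> module.subspace (scale_via id) H \<longrightarrow>
          vector_space.dim (scale_via id) H = h \<longrightarrow>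
          real (vector_space.dim (scale_via e) (U \<inter> H)) \<le> s)"

definition cyc_succ :: "nat \<Rightarrow> nat \<Rightarrow> nat" where
  "cyc_succ m i = (if i < m then i + 1 else 1)"

definition f_poly ::
  "nat \<Rightarrow> nat \<Rightarrow> nat \<Rightarrow> nat \<Rightarrow> (nat \<Rightarrow> 'a::field) \<Rightarrow> nat \<Rightarrow> (nat \<Rightarrow> 'a) \<Rightarrow> 'a" where
  "f_poly q I J m \<alpha> i x =
     x i ^ (q ^ I) + \<alpha> (cyc_succ m i) * x (cyc_succ m i) ^ (q ^ J)"

definition U_space ::
  "nat \<Rightarrow> nat \<Rightarrow> nat \<Rightarrow> nat \<Rightarrow> (nat \<Rightarrow> 'a::field) \<Rightarrow> (nat \<Rightarrow> 'a) set" where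
  "U_space q I J m \<alpha> =
     {(\<lambda>j. if j \<in> {1..m} then x j
           else if j \<in> {m+1..2*m} then f_poly q I J m \<alpha> (j - m) x
           else 0) | x. x \<in> coord_space m}"

end

theory Submission
  imports Defs "HOL-Computational_Algebra.Polynomial"
begin

text \<open>
  Let \<open>F\<close> be the field with \<open>q ^ n\<close> elements, \<open>G x = (x, f x)\<close> the parametrization of \<open>U\<close>, \<open>H\<close> a
  subspace of dimension \<open>r\<close>, and \<open>T = {x. G x \<in> H}\<close>, of dimension \<open>D\<close> over the base field. Consider
  the \<open>m\<close>-tuples \<open>v\<close> of linearized polynomials of \<open>q\<close>-degree less than \<open>n - J\<close> with values in \<open>T\<close>.
  The tuples of \<open>q\<close>-degree less than \<open>n\<close> with values in \<open>T\<close> are the linear maps \<open>F \<rightarrow> T\<close>, of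
  dimension \<open>D\<close> over \<open>F\<close>, and killing the top \<open>J\<close> coefficient vectors costs at most \<open>m * J\<close>.
  Precomposition with Frobenius shifts coefficients, so if the coefficient vectors at degree
  \<open>n - J - 1\<close> and at degree \<open>0\<close> form \<open>F\<close>-spaces \<open>A\<close> and \<open>B\<close> of dimensions \<open>a\<close> and \<open>b\<close>, then
  \<open>D \<le> a * (n - J) + m * J\<close> and likewise for \<open>b\<close>.

  Since \<open>G (v t)\<close> has \<open>q\<close>-degree less than \<open>n\<close>, no wrap-around occurs and all its coefficient
  vectors lie in \<open>H\<close>. The top one is \<open>(0, *)\<close> and determined injectively by a vector of \<open>A\<close>, the
  bottom one is \<open>(y, *)\<close> with \<open>y \<in> B\<close>. Hence \<open>a + b \<le> r\<close>, and as \<open>r\<close> is odd, one of \<open>a\<close>, \<open>b\<close>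
  is at most \<open>(r - 1) / 2\<close>.
\<close>

section \<open>Counting\<close>

text \<open>A largest fibre of \<open>f\<close> has at least the average size, and subtracting the
  \<open>h\<close>-image of one of its points embeds it in \<open>M\<close>. For linear
  \<open>f\<close> this bounds by image times kernel; \<open>h\<close> allows re-encoding elements
  before subtracting.\<close>

lemma card_le_card_times_fibre_differences:
  fixes h :: "'a \<Rightarrow> 'b::ab_group_add"
  assumes "f \<in> S \<rightarrow> Y" "finite S" "finite Y" "finite M"
    and inj: "\<And>x y. x \<in> S \<Longrightarrow> y \<in> S \<Longrightarrow> f x = f y \<Longrightarrow> h x = h y \<Longrightarrow> x = y"
    and diff: "\<And>x y. x \<in> S \<Longrightarrow> y \<in> S \<Longrightarrow> f x = f y \<Longrightarrow> h x - h y \<in> M"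
  shows "card S \<le> card Y * card M"
proof (cases "S = {}")
  case False
  then have "Y \<noteq> {}" using assms(1) by auto
  then obtain y where y: "y \<in> Y" "card S \<le> card (f -` {y} \<inter> S) * card Y"
    using pigeonhole_card[OF assms(1-3)] by blast
  have "card (f -` {y} \<inter> S) \<le> card M"
  proof (cases "f -` {y} \<inter> S = {}")
    case False
    then obtain x0 where x0: "x0 \<in> S" "f x0 = y" by auto
    show ?thesis
    proof (rule card_inj_on_le[where f = "\<lambda>x. h x - h x0"])
      show "inj_on (\<lambda>x. h x - h x0) (f -` {y} \<inter> S)"
        by (rule inj_onI) (auto intro: inj)
      show "(\<lambda>x. h x - h x0) ` (f -` {y} \<inter> S) \<subseteq> M"
        using x0 by (auto intro: diff)
    qed (rule assms)
  qed simp
  with y(2) show ?thesis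
    by (metis le_trans mult.commute mult_le_mono1)
qed simp

lemma
  fixes S :: "'b::zero set"
  assumes "finite A" "finite S"
  shows finite_functions_vanishing_outside:
      "finite {f. (\<forall>i\<in>A. f i \<in> S) \<and> (\<forall>i. i \<notin> A \<longrightarrow> f i = 0)}" (is "finite ?X")
    and card_functions_vanishing_outside:
      "card {f. (\<forall>i\<in>A. f i \<in> S) \<and> (\<forall>i. i \<notin> A \<longrightarrow> f i = 0)} = card S ^ card A"
proof -
  have bij: "bij_betw (\<lambda>f. restrict f A) ?X (A \<rightarrow>\<^sub>E S)"
  proof (rule bij_betw_byWitness[where f' = "\<lambda>f i. if i \<in> A then f i else 0"])
    show "\<forall>f\<in>A \<rightarrow>\<^sub>E S. restrict (\<lambda>i. if i \<in> A then f i else 0) A = f"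
    proof
      fix f assume "f \<in> A \<rightarrow>\<^sub>E S"
      then show "restrict (\<lambda>i. if i \<in> A then f i else 0) A = f"
        by (intro PiE_ext[of _ A "\<lambda>_. S"]) (auto simp: PiE_iff)
    qed
    show "\<forall>f\<in>?X. (\<lambda>i. if i \<in> A then restrict f A i else 0) = f"
      by (intro ballI ext) simp
  qed auto
  show "finite ?X"
    using bij_betw_finite[OF bij] finite_PiE[OF assms(1), of "\<lambda>_. S"] assms(2) by auto
  show "card ?X = card S ^ card A"
    using bij_betw_same_card[OF bij] card_funcsetE[OF assms(1)] by auto
qed

text \<open>Coordinates in a basis. The dimension inequalities below are read off from cardinalities
  through this.\<close>

lemma (in vector_space) card_subspace_eq_power_dim:
  assumes "finite (UNIV :: 'a set)" "subspace S" "finite S"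
  shows "card S = CARD('a) ^ dim S"
proof -
  obtain B where B: "B \<subseteq> S" "independent B" "S \<subseteq> span B" "card B = dim S"
    using basis_exists by blast
  have fin: "finite B" using B(1) assms(3) finite_subset by blast
  have span: "span B = S"
    using B assms(2) span_minimal by blast
  define g where "g u = (\<Sum>v\<in>B. u v *s v)" for u
  have "bij_betw g (B \<rightarrow>\<^sub>E UNIV) S"
  proof (rule bij_betw_imageI)
    show "inj_on g (B \<rightarrow>\<^sub>E UNIV)"
    proof (rule inj_onI)
      fix u w assume u: "u \<in> B \<rightarrow>\<^sub>E UNIV" "w \<in> B \<rightarrow>\<^sub>E UNIV" and eq: "g u = g w"
      have "(\<Sum>v\<in>B. (u v - w v) *s v) = 0"
        using eq by (simp add: g_def scale_left_diff_distrib sum_subtractf)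
      then have "u v - w v = 0" if "v \<in> B" for v
        using independentD[OF B(2) fin subset_refl, of "\<lambda>v. u v - w v"] that by simp
      then show "u = w"
        using u by (intro PiE_ext[of u B "\<lambda>_. UNIV"]) auto
    qed
    show "g ` (B \<rightarrow>\<^sub>E UNIV) = S"
    proof (intro equalityI subsetI)
      fix x assume "x \<in> S"
      then obtain u where "x = g u"
        using span span_finite[OF fin] by (auto simp: g_def)
      then have "x = g (restrict u B)" by (simp add: g_def)
      then show "x \<in> g ` (B \<rightarrow>\<^sub>E UNIV)" by auto
    qed (use span span_finite[OF fin] in \<open>auto simp: g_def\<close>)
  qed
  then show ?thesis
    using card_funcsetE[OF fin, of "UNIV :: 'a set"] B(4) by (simp add: bij_betw_same_card)
qed

section \<open>Finite fields\<close>

lemma CARD_field_gt_1: "CARD('a::{field,finite}) > 1"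
proof -
  have "card {0, 1 :: 'a} \<le> CARD('a)" by (rule card_mono) auto
  then show ?thesis by simp
qed

text \<open>The shift by 1 permutes the ring and so preserves the sum of all elements.\<close>

lemma of_nat_CARD_eq_0: "of_nat CARD('a) = (0 :: 'a::{ring_1,finite})"
proof -
  have "(\<Sum>x\<in>UNIV. x + 1) = (\<Sum>x\<in>UNIV. x :: 'a)"
    by (rule sum.reindex_bij_witness[of _ "\<lambda>x. x - 1" "\<lambda>x. x + 1"]) auto
  then show ?thesis by (simp add: sum.distrib)
qed

lemma power_CARD_minus_1_eq_1:
  fixes x :: "'a::{field,finite}"
  assumes "x \<noteq> 0"
  shows "x ^ (CARD('a) - 1) = 1"
proof -
  have "(\<Prod>y\<in>UNIV-{0}. x * y) = (\<Prod>y\<in>UNIV-{0}. y)"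
    by (rule prod.reindex_bij_witness[of _ "\<lambda>y. y / x" "\<lambda>y. x * y"]) (use assms in auto)
  then have "x ^ (CARD('a) - 1) * \<Prod>(UNIV-{0}) = 1 * \<Prod>(UNIV-{0})"
    by (simp add: prod.distrib card_Diff_singleton)
  then show ?thesis
    by (subst (asm) mult_right_cancel) auto
qed

lemma power_CARD_eq_same: "x ^ CARD('a) = (x :: 'a::{field,finite})"
proof (cases "x = 0")
  case False
  have "x ^ CARD('a) = x ^ (CARD('a) - 1) * x"
    by (simp flip: power_Suc2)
  also have "\<dots> = x" using power_CARD_minus_1_eq_1[OF False] by simp
  finally show ?thesis .
qed simp

text \<open>Substituting \<open>u * t\<close> for \<open>t\<close> multiplies the sum by
  \<open>u ^ i\<close>, so one nonzero \<open>u\<close> with \<open>u ^ i \<noteq> 1\<close>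
  suffices.\<close>

lemma sum_powers_eq_0:
  assumes "\<not> (CARD('a) - 1) dvd i"
  shows "(\<Sum>t\<in>UNIV. t ^ i) = (0 :: 'a::{field,finite})"
proof -
  let ?N = "CARD('a) - 1"
  define d where "d = i mod ?N"
  have N: "?N > 0" using CARD_field_gt_1[where 'a = 'a] by simp
  have d: "0 < d" "d < ?N"
    using assms N by (auto simp: d_def mod_greater_zero_iff_not_dvd)
  have red: "u ^ i = u ^ d" if "u \<noteq> 0" for u :: 'a
  proof -
    have "u ^ i = u ^ (?N * (i div ?N) + d)" by (simp add: d_def)
    then show ?thesis
      using power_CARD_minus_1_eq_1[OF that] by (simp add: power_add power_mult)
  qed
  \<comment> \<open>The polynomial \<open>monom 1 d - 1\<close> has at most \<open>d\<close> roots,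
    fewer than there are nonzero elements.\<close>
  have "\<exists>u :: 'a. u \<noteq> 0 \<and> u ^ d \<noteq> 1"
  proof (rule ccontr)
    assume "\<not> (\<exists>u :: 'a. u \<noteq> 0 \<and> u ^ d \<noteq> 1)"
    then have all: "u ^ d = 1" if "u \<noteq> 0" for u :: 'a using that by blast
    let ?p = "monom 1 d - 1 :: 'a poly"
    have "degree ?p \<le> d"
      by (intro degree_diff_le) (auto simp: degree_monom_eq)
    moreover have "coeff ?p d = 1" using d by simp
    then have "?p \<noteq> 0" by fastforce
    then have "card {x. poly ?p x = 0} \<le> degree ?p"
      by (rule card_poly_roots_bound)
    moreover have "card (UNIV - {0 :: 'a}) \<le> card {x. poly ?p x = 0}"
      by (rule card_mono) (use all in \<open>auto simp: poly_monom\<close>)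
    ultimately show False using d by simp
  qed
  then obtain u :: 'a where u: "u \<noteq> 0" "u ^ d \<noteq> 1" by blast
  have "(\<Sum>t\<in>UNIV. t ^ i) = (\<Sum>t\<in>UNIV. (u * t) ^ i)"
    by (rule sum.reindex_bij_witness[of _ "\<lambda>t. u * t" "\<lambda>t. t / u"]) (use u in auto)
  also have "\<dots> = u ^ i * (\<Sum>t\<in>UNIV. t ^ i)"
    by (simp add: power_mult_distrib sum_distrib_left)
  finally have "(1 - u ^ i) * (\<Sum>t\<in>UNIV. t ^ i) = 0"
    by (simp add: algebra_simps)
  then show ?thesis using u red by auto
qed

lemma sum_power_CARD_minus_1:
  "(\<Sum>t\<in>UNIV. t ^ (CARD('a) - 1)) = (-1 :: 'a::{field,finite})"
proof -
  note N = CARD_field_gt_1[where 'a = 'a]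
  have "(\<Sum>t\<in>UNIV. t ^ (CARD('a) - 1)) = (\<Sum>t\<in>UNIV - {0 :: 'a}. 1 :: 'a)"
    by (intro sum.mono_neutral_cong_right)
      (use N power_CARD_minus_1_eq_1 in \<open>auto simp: power_0_left\<close>)
  also have "\<dots> = of_nat (CARD('a) - 1)" by simp
  also have "\<dots> = -1" using N by (simp add: of_nat_diff of_nat_CARD_eq_0)
  finally show ?thesis .
qed

section \<open>Coordinate spaces over a finite field\<close>

lemma coord_space_eq:
  "coord_space k = {f. (\<forall>i\<in>{1..k}. f i \<in> UNIV) \<and> (\<forall>i. i \<notin> {1..k} \<longrightarrow> f i = 0)}"
  by (simp add: coord_space_def)

lemma finite_coord_space: "finite (coord_space k :: (nat \<Rightarrow> 'a::{field,finite}) set)"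
  unfolding coord_space_eq by (rule finite_functions_vanishing_outside) auto

lemma card_coord_space: "card (coord_space k :: (nat \<Rightarrow> 'a::{field,finite}) set) = CARD('a) ^ k"
  unfolding coord_space_eq by (subst card_functions_vanishing_outside) auto

lemma coord_space_diff: "x \<in> coord_space m \<Longrightarrow> y \<in> coord_space m \<Longrightarrow> x - y \<in> coord_space m"
  by (auto simp: coord_space_def)

lemma coord_space_add: "x \<in> coord_space m \<Longrightarrow> y \<in> coord_space m \<Longrightarrow> x + y \<in> coord_space m"
  by (auto simp: coord_space_def)

lemma zero_in_coord_space: "0 \<in> coord_space m"
  by (auto simp: coord_space_def)

section \<open>Linearized polynomials over a finite field extension\<close>

locale finite_field_extension =
  fixes e :: "'k::{field,finite} \<Rightarrow> 'a::{field,finite}" and q n :: nat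
  assumes primepow_q: "primepow q"
    and n_pos: "n > 0"
    and CARD_base: "CARD('k) = q"
    and CARD_ext: "CARD('a) = q ^ n"
    and embedding: "field_embedding e"
begin

sublocale base: vector_space "scale_via e"
  by (rule vector_space_scale_via[OF embedding])

sublocale ext: vector_space "scale_via (id :: 'a \<Rightarrow> 'a)"
  by (rule vector_space_scale_via_id)

text \<open>The extension field itself over the base field, the domain of the linear maps to be
  counted.\<close>

sublocale line: vector_space "\<lambda>c (x :: 'a). e c * x"
  using embedding by unfold_locales (auto simp: field_embedding_def algebra_simps)

section \<open>Frobenius powers\<close>

lemma q_gt_1: "q > 1"
  using CARD_field_gt_1[where 'a = 'k] CARD_base by simp

text \<open>The field size is a power of the prime \<open>p\<close> under \<open>q\<close> and
  vanishes in the field, so \<open>p\<close> is the characteristic.\<close>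

lemma frobenius_add: "(x + y) ^ (q ^ k) = x ^ (q ^ k) + (y :: 'a) ^ (q ^ k)"
proof -
  obtain p a where p: "prime p" "q = p ^ a"
    using primepow_q by (auto simp: primepow_def)
  have "of_nat p ^ (a * n) = (0 :: 'a)"
    using of_nat_CARD_eq_0[where 'a = 'a] by (simp add: CARD_ext p(2) power_mult)
  then have "of_nat p = (0 :: 'a)" by simp
  then have "CHAR('a) dvd p" by (simp add: of_nat_eq_0_iff_char_dvd)
  moreover have "CHAR('a) \<noteq> 1" by simp
  ultimately have "CHAR('a) = p"
    using p(1) prime_nat_iff by blast
  then show ?thesis
    using p by (intro freshmans_dream'[where n = "a * k"]) (auto simp: power_mult)
qed

lemma frobenius_diff: "(x - y) ^ (q ^ k) = x ^ (q ^ k) - (y :: 'a) ^ (q ^ k)"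
  using frobenius_add[of "x - y" y k] by simp

lemma frobenius_sum: "(\<Sum>i\<in>A. f i) ^ (q ^ k) = (\<Sum>i\<in>A. f i ^ (q ^ k) :: 'a)"
  using q_gt_1 by (induction A rule: infinite_finite_induct) (auto simp: frobenius_add)

lemma frobenius_eq_iff: "x ^ (q ^ k) = y ^ (q ^ k) \<longleftrightarrow> x = (y :: 'a)"
  using frobenius_diff[of x y k] by auto

lemma frobenius_surj:
  obtains y :: 'a where "x = y ^ (q ^ k)"
proof -
  have "surj (\<lambda>y :: 'a. y ^ (q ^ k))"
    by (rule finite_UNIV_inj_surj) (auto intro: injI simp: frobenius_eq_iff)
  then show ?thesis using that by blast
qed

lemma embedding_power: "e (c ^ i) = e c ^ i"
  using embedding by (induction i) (auto simp: field_embedding_def)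

lemma frobenius_embedding: "e c ^ (q ^ k) = e c"
proof (induction k)
  case (Suc k)
  have "e c ^ q = e c"
    using power_CARD_eq_same[of c] by (simp add: CARD_base flip: embedding_power)
  then show ?case by (simp add: power_mult Suc)
qed simp

section \<open>Tuples of linearized polynomials\<close>

definition qeval :: "nat \<Rightarrow> (nat \<Rightarrow> nat \<Rightarrow> 'a) \<Rightarrow> 'a \<Rightarrow> nat \<Rightarrow> 'a" where
  "qeval K v t = (\<lambda>j. \<Sum>k<K. v k j * t ^ (q ^ k))"

text \<open>Tuples of linearized polynomials of \<open>q\<close>-degree less than \<open>K\<close> with values in \<open>T\<close>; the
  entry \<open>v k\<close> is the vector of the coefficients of \<open>t ^ (q ^ k)\<close>.\<close>

definition qmaps :: "nat \<Rightarrow> nat \<Rightarrow> (nat \<Rightarrow> 'a) set \<Rightarrow> (nat \<Rightarrow> nat \<Rightarrow> 'a) set" where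
  "qmaps m K T =
     {v. (\<forall>k. v k \<in> coord_space m) \<and> (\<forall>k\<ge>K. v k = 0) \<and> (\<forall>t. qeval K v t \<in> T)}"

lemma qeval_add_coeffs: "qeval K (v + w) t = qeval K v t + qeval K w t"
  by (auto simp: qeval_def fun_eq_iff algebra_simps sum.distrib)

lemma qeval_diff_coeffs: "qeval K (v - w) t = qeval K v t - qeval K w t"
  by (auto simp: qeval_def fun_eq_iff algebra_simps sum_subtractf)

lemma qeval_add: "qeval K v (s + t) = qeval K v s + qeval K v t"
  by (auto simp: qeval_def fun_eq_iff algebra_simps sum.distrib frobenius_add)

lemma qeval_scale: "qeval K v (e c * t) = scale_via e c (qeval K v t)"
  by (auto simp: qeval_def scale_via_def fun_eq_iff sum_distrib_left power_mult_distrib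
      frobenius_embedding intro!: sum.cong)

lemma qeval_0: "qeval K v 0 = 0"
  using q_gt_1 by (auto simp: qeval_def fun_eq_iff power_0_left)

lemma qeval_Suc_frobenius:
  assumes "v 0 = 0"
  shows "qeval (Suc K) v t = qeval K (\<lambda>k. v (Suc k)) (t ^ q)"
  using assms
  by (auto simp: qeval_def fun_eq_iff sum.lessThan_Suc_shift power_mult simp del: sum.lessThan_Suc)

lemma qeval_Suc_eq: "v K = 0 \<Longrightarrow> qeval (Suc K) v t = qeval K v t"
  by (auto simp: qeval_def fun_eq_iff)

lemma finite_qmaps: "finite (qmaps m K T)"
proof (rule finite_subset)
  show "qmaps m K T \<subseteq> {v. (\<forall>k\<in>{..<K}. v k \<in> coord_space m) \<and> (\<forall>k. k \<notin> {..<K} \<longrightarrow> v k = 0)}"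
    by (auto simp: qmaps_def)
  show "finite \<dots>"
    by (rule finite_functions_vanishing_outside) (auto simp: finite_coord_space)
qed

lemma qmaps_add:
  assumes "base.subspace T" "v \<in> qmaps m K T" "w \<in> qmaps m K T"
  shows "v + w \<in> qmaps m K T"
  using assms base.subspace_add
  by (auto simp: qmaps_def coord_space_add qeval_add_coeffs)

lemma qmaps_diff:
  assumes "base.subspace T" "v \<in> qmaps m K T" "w \<in> qmaps m K T"
  shows "v - w \<in> qmaps m K T"
  using assms base.subspace_diff
  by (auto simp: qmaps_def coord_space_diff qeval_diff_coeffs)

lemma qmaps_0:
  assumes "base.subspace T"
  shows "0 \<in> qmaps m K T"
proof -
  have "qeval K 0 t = 0" for t by (simp add: qeval_def fun_eq_iff)
  then show ?thesis
    using base.subspace_0[OF assms] by (simp add: qmaps_def zero_in_coord_space)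
qed

lemma qmaps_Suc: "v \<in> qmaps m K T \<Longrightarrow> v \<in> qmaps m (Suc K) T"
  by (auto simp: qmaps_def qeval_Suc_eq)

lemma qmaps_mono:
  assumes "K \<le> L" "v \<in> qmaps m K T"
  shows "v \<in> qmaps m L T"
  using assms by (induction L rule: dec_induct) (auto intro: qmaps_Suc)

text \<open>The new tuple at \<open>t\<close> is the old one at \<open>t ^ q\<close>, so no new
  values arise.\<close>

lemma qmaps_shift_up:
  assumes "v \<in> qmaps m K T"
  shows "(\<lambda>k. if k = 0 then 0 else v (k - 1)) \<in> qmaps m (Suc K) T"
  using assms by (auto simp: qmaps_def zero_in_coord_space qeval_Suc_frobenius)

text \<open>Precomposition with the inverse of Frobenius, which is bijective on a finite
  field.\<close>

lemma qmaps_shift_down: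
  assumes "v \<in> qmaps m (Suc K) T" "v 0 = 0"
  shows "(\<lambda>k. v (Suc k)) \<in> qmaps m K T"
proof -
  have "qeval K (\<lambda>k. v (Suc k)) t \<in> T" for t
  proof -
    obtain s where s: "t = s ^ (q ^ 1)" by (rule frobenius_surj)
    then have "qeval K (\<lambda>k. v (Suc k)) t = qeval (Suc K) v s"
      using qeval_Suc_frobenius[of v K s, OF assms(2)] by simp
    then show ?thesis using assms(1) by (simp add: qmaps_def)
  qed
  then show ?thesis using assms(1) by (auto simp: qmaps_def)
qed

text \<open>\<open>T\<close> is closed only under base scalars, yet replacing \<open>t\<close> by
  \<open>d * t\<close> keeps all values in \<open>T\<close> and multiplies the \<open>i\<close>-th
  coefficient vector by \<open>d ^ (q ^ i)\<close>, which can be any element of the extension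
  field.\<close>

lemma subspace_qmaps_coeffs:
  assumes "base.subspace T"
  shows "ext.subspace ((\<lambda>v. v i) ` qmaps m K T)"
proof (rule ext.subspaceI)
  show "0 \<in> (\<lambda>v. v i) ` qmaps m K T"
    using qmaps_0[OF assms, of m K] by (intro image_eqI[of _ _ 0]) simp_all
next
  fix x y assume "x \<in> (\<lambda>v. v i) ` qmaps m K T" "y \<in> (\<lambda>v. v i) ` qmaps m K T"
  then obtain v w where "v \<in> qmaps m K T" "w \<in> qmaps m K T" "x = v i" "y = w i" by auto
  then show "x + y \<in> (\<lambda>v. v i) ` qmaps m K T"
    using qmaps_add[OF assms, of v m K w] by (intro image_eqI[of _ _ "v + w"]) simp_all
next
  fix c :: 'a and x assume "x \<in> (\<lambda>v. v i) ` qmaps m K T"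
  then obtain v where v: "v \<in> qmaps m K T" "x = v i" by auto
  obtain d where d: "c = d ^ (q ^ i)" by (rule frobenius_surj)
  define w where "w = (\<lambda>k j. v k j * d ^ (q ^ k))"
  have "qeval K w t = qeval K v (d * t)" for t
    by (auto simp: w_def qeval_def power_mult_distrib mult.assoc)
  moreover have "w k \<in> coord_space m" for k
    using v(1) by (simp add: qmaps_def w_def coord_space_def)
  moreover have "w k = 0" if "k \<ge> K" for k
    using v(1) that by (simp add: qmaps_def w_def fun_eq_iff)
  ultimately have "w \<in> qmaps m K T"
    using v(1) by (simp add: qmaps_def)
  moreover have "scale_via id c x = w i"
    by (simp add: w_def v(2) d scale_via_def mult.commute)
  ultimately show "scale_via id c x \<in> (\<lambda>v. v i) ` qmaps m K T" by blast
qed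

section \<open>Counting tuples through their extreme coefficients\<close>

lemma card_qmaps_0: "card (qmaps m 0 T) \<le> Suc 0"
proof -
  have "qmaps m 0 T \<subseteq> {0}" by (auto simp: qmaps_def fun_eq_iff)
  then show ?thesis using card_mono[of "{0}"] by simp
qed

lemma top_coeffs_mono:
  assumes "k \<le> d"
  shows "(\<lambda>v. v k) ` qmaps m (Suc k) T \<subseteq> (\<lambda>v. v d) ` qmaps m (Suc d) T"
  using assms
proof (induction d rule: dec_induct)
  case (step d)
  have "(\<lambda>v. v d) ` qmaps m (Suc d) T \<subseteq> (\<lambda>v. v (Suc d)) ` qmaps m (Suc (Suc d)) T"
  proof (rule image_subsetI)
    fix v assume "v \<in> qmaps m (Suc d) T"
    then show "v d \<in> (\<lambda>v. v (Suc d)) ` qmaps m (Suc (Suc d)) T"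
      by (intro image_eqI[OF _ qmaps_shift_up]) simp_all
  qed
  with step.IH show ?case by blast
qed simp

text \<open>Peel off the top coefficient \<open>K\<close> times: by \<open>top_coeffs_mono\<close>
  it always lies in the same set, and tuples agreeing there differ by one of smaller degree.\<close>

lemma card_qmaps_le_top_coeffs:
  assumes "base.subspace T" "K \<le> Suc d"
  shows "card (qmaps m K T) \<le> card ((\<lambda>v. v d) ` qmaps m (Suc d) T) ^ K"
  using assms(2)
proof (induction K)
  case (Suc k)
  let ?A = "(\<lambda>v. v d) ` qmaps m (Suc d) T"
  have "card (qmaps m (Suc k) T) \<le> card ?A * card (qmaps m k T)"
  proof (rule card_le_card_times_fibre_differences[where h = id])
    show "(\<lambda>v. v k) \<in> qmaps m (Suc k) T \<rightarrow> ?A"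
      using top_coeffs_mono[of k d m T] Suc.prems by auto
    fix v w assume v: "v \<in> qmaps m (Suc k) T" "w \<in> qmaps m (Suc k) T" "v k = w k"
    then have "v - w \<in> qmaps m (Suc k) T" by (intro qmaps_diff assms)
    moreover have "(v - w) k = 0" using v by simp
    ultimately show "id v - id w \<in> qmaps m k T"
      by (auto simp: qmaps_def qeval_Suc_eq) (metis Suc_leI le_neq_implies_less)
  qed (auto simp: finite_qmaps)
  also have "\<dots> \<le> card ?A * card ?A ^ k"
    using Suc by (intro mult_left_mono) auto
  finally show ?case by simp
qed (simp add: card_qmaps_0)

text \<open>The same peeling from below. A difference within a fibre has no coefficient at 0, so it
  is shifted down; \<open>h\<close> performs this shift.\<close>

lemma card_qmaps_le_bottom_coeffs:
  assumes "base.subspace T" "K \<le> L"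
  shows "card (qmaps m K T) \<le> card ((\<lambda>v. v 0) ` qmaps m L T) ^ K"
  using assms(2)
proof (induction K)
  case (Suc k)
  let ?B = "(\<lambda>v. v 0) ` qmaps m L T"
  have "card (qmaps m (Suc k) T) \<le> card ?B * card (qmaps m k T)"
  proof (rule card_le_card_times_fibre_differences[where h = "\<lambda>v k. v (Suc k)"])
    show "(\<lambda>v. v 0) \<in> qmaps m (Suc k) T \<rightarrow> ?B"
      using qmaps_mono[OF Suc.prems, of _ m T] by auto
    fix v w assume v: "v \<in> qmaps m (Suc k) T" "w \<in> qmaps m (Suc k) T" "v 0 = w 0"
    show "v = w" if "(\<lambda>k. v (Suc k)) = (\<lambda>k. w (Suc k))"
      using that v(3) by (metis (no_types, lifting) ext not0_implies_Suc)
    have "v - w \<in> qmaps m (Suc k) T" using v by (intro qmaps_diff assms)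
    moreover have "(v - w) 0 = 0" using v by simp
    ultimately have "(\<lambda>k. (v - w) (Suc k)) \<in> qmaps m k T"
      by (rule qmaps_shift_down)
    then show "(\<lambda>k. v (Suc k)) - (\<lambda>k. w (Suc k)) \<in> qmaps m k T"
      by (simp add: fun_diff_def)
  qed (auto simp: finite_qmaps)
  also have "\<dots> \<le> card ?B * card ?B ^ k"
    using Suc by (intro mult_left_mono) auto
  finally show ?case by simp
qed (simp add: card_qmaps_0)

lemma obtain_basis:
  obtains B :: "'a set" where "finite B" "card B = n" "line.span B = UNIV"
proof -
  obtain B where B: "B \<subseteq> UNIV" "line.independent B" "UNIV \<subseteq> line.span B" "card B = line.dim UNIV"
    by (rule line.basis_exists[of UNIV])
  have "CARD('a) = CARD('k) ^ line.dim UNIV"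
    by (rule line.card_subspace_eq_power_dim) (auto simp: line.subspace_def)
  then have "q ^ n = q ^ line.dim UNIV" by (simp add: CARD_ext CARD_base)
  then have "line.dim UNIV = n" using q_gt_1 by (simp add: power_inject_exp)
  with B show ?thesis by (intro that[of B]) auto
qed

text \<open>The dimension formula for an intersection, by counting: among the linear maps from the
  field to \<open>coord_space m\<close>, those of \<open>q\<close>-degree below \<open>K\<close>
  meet those with values in \<open>T\<close>.\<close>

lemma card_subspace_power_le_card_qmaps:
  assumes T: "base.subspace T" "T \<subseteq> coord_space m" and K: "K \<le> n"
  shows "card T ^ n \<le> card (qmaps m K T) * CARD('a) ^ (m * (n - K))"
proof -
  obtain B :: "'a set" where B: "finite B" "card B = n" "line.span B = UNIV"
    by (rule obtain_basis)
  define X :: "(nat \<Rightarrow> nat \<Rightarrow> 'a) set" where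
    "X = {v. (\<forall>k\<in>{..<K}. v k \<in> coord_space m) \<and> (\<forall>k. k \<notin> {..<K} \<longrightarrow> v k = 0)}"
  have "finite X"
    unfolding X_def by (rule finite_functions_vanishing_outside) (auto simp: finite_coord_space)
  moreover have "card X = card (coord_space m :: (nat \<Rightarrow> 'a) set) ^ card {..<K}"
    unfolding X_def by (rule card_functions_vanishing_outside) (auto simp: finite_coord_space)
  ultimately have X: "finite X" "card X = CARD('a) ^ (m * K)"
    by (simp_all add: card_coord_space power_mult)
  have X_coord: "v k \<in> coord_space m" if "v \<in> X" for v k
    using that by (cases "k < K") (auto simp: X_def zero_in_coord_space)
  have qeval_coord: "qeval K v b \<in> coord_space m" if "v \<in> X" for v b
    using X_coord[OF that] by (auto simp: coord_space_def qeval_def)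
  have finT: "finite T" using T(2) finite_coord_space finite_subset by blast
  \<comment> \<open>\<open>\<tau>\<close> encodes a linear map into \<open>T\<close> by its values
    on the basis \<open>B\<close>; \<open>f\<close> adds it to the map given by
    \<open>v\<close>.\<close>
  define f where "f = (\<lambda>(v, \<tau>). \<lambda>b\<in>B. qeval K v b + \<tau> b :: nat \<Rightarrow> 'a)"
  have "card (X \<times> (B \<rightarrow>\<^sub>E T)) \<le> card (B \<rightarrow>\<^sub>E (coord_space m :: (nat \<Rightarrow> 'a) set)) * card (qmaps m K T)"
  proof (rule card_le_card_times_fibre_differences[where f = f and h = fst])
    show "f \<in> X \<times> (B \<rightarrow>\<^sub>E T) \<rightarrow> (B \<rightarrow>\<^sub>E coord_space m)"
      using T(2) by (auto simp: f_def intro!: coord_space_add qeval_coord)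
    show "finite (X \<times> (B \<rightarrow>\<^sub>E T))"
      using X finT B by (intro finite_cartesian_product finite_PiE) auto
    show "finite (B \<rightarrow>\<^sub>E (coord_space m :: (nat \<Rightarrow> 'a) set))"
      using B by (auto intro: finite_PiE finite_coord_space)
    show "finite (qmaps m K T)" by (rule finite_qmaps)
    fix x y assume xy: "x \<in> X \<times> (B \<rightarrow>\<^sub>E T)" "y \<in> X \<times> (B \<rightarrow>\<^sub>E T)" "f x = f y"
    obtain v \<sigma> w \<tau> where [simp]: "x = (v, \<sigma>)" "y = (w, \<tau>)" by (cases x; cases y)
    have eq: "qeval K v b + \<sigma> b = qeval K w b + \<tau> b" if "b \<in> B" for b
      using fun_cong[OF xy(3), of b] that by (simp add: f_def)
    show "x = y" if "fst x = fst y"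
    proof -
      have "\<sigma> b = \<tau> b" if "b \<in> B" for b
        using eq[OF that] \<open>fst x = fst y\<close> by simp
      then have "\<sigma> = \<tau>" using xy by (intro PiE_ext[of \<sigma> B "\<lambda>_. T"]) auto
      with that show ?thesis by simp
    qed
    \<comment> \<open>Within a fibre \<open>v - w\<close> takes values in \<open>T\<close> on
      \<open>B\<close>; linearity over the base field extends this to all \<open>t\<close>.\<close>
    have "line.subspace {t. qeval K (v - w) t \<in> T}"
      using T(1) by (intro line.subspaceI)
        (auto simp: qeval_0 qeval_add qeval_scale base.subspace_0 base.subspace_add base.subspace_scale)
    moreover have "qeval K (v - w) b \<in> T" if "b \<in> B" for b
    proof -
      have "qeval K (v - w) b = \<tau> b - \<sigma> b"
        using eq[OF that] by (simp add: qeval_diff_coeffs algebra_simps)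
      then show ?thesis
        using xy that by (auto intro!: base.subspace_diff[OF T(1)])
    qed
    ultimately have "line.span B \<subseteq> {t. qeval K (v - w) t \<in> T}"
      by (intro line.span_minimal) auto
    then have "qeval K (v - w) t \<in> T" for t using B(3) by blast
    moreover have "(v - w) k \<in> coord_space m" for k
      using xy X_coord[of v k] X_coord[of w k] by (simp add: coord_space_diff)
    moreover have "(v - w) k = 0" if "k \<ge> K" for k
      using xy that by (simp add: X_def)
    ultimately show "fst x - fst y \<in> qmaps m K T"
      by (simp add: qmaps_def)
  qed
  then have "CARD('a) ^ (m * K) * card T ^ n \<le> CARD('a) ^ (m * n) * card (qmaps m K T)"
    unfolding card_cartesian_product card_funcsetE[OF B(1)] card_coord_space B(2) X(2)
    by (simp add: power_mult)
  also have "CARD('a) ^ (m * n) = CARD('a) ^ (m * K) * CARD('a) ^ (m * (n - K))"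
    using K by (simp flip: power_add distrib_left)
  finally have "CARD('a) ^ (m * K) * card T ^ n \<le>
      CARD('a) ^ (m * K) * (card (qmaps m K T) * CARD('a) ^ (m * (n - K)))"
    by (simp only: mult_ac)
  then show ?thesis by (subst (asm) mult_le_cancel1) simp
qed

text \<open>By orthogonality of power sums, the \<open>l\<close>-th coefficient vector is
  \<open>- (\<Sum>t. t ^ (Q - 1 - q ^ l) * qeval n g t)\<close> where \<open>Q = CARD('a)\<close>.\<close>

lemma coeff_in_subspace:
  assumes H: "ext.subspace H" and g: "\<And>t. qeval n g t \<in> H" and l: "l < n"
  shows "g l \<in> H"
proof -
  let ?Q = "CARD('a)"
  have less: "q ^ i \<le> ?Q - 1" if "i < n" for i
    using power_strict_increasing[OF that q_gt_1] by (simp add: CARD_ext)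
  \<comment> \<open>For \<open>i = l\<close> the exponents add up to \<open>?Q - 1\<close>.
    Otherwise the total lies strictly between 0 and \<open>2 * (?Q - 1)\<close> and differs from
    \<open>?Q - 1\<close>, hence is no multiple of it.\<close>
  have ortho: "(\<Sum>t\<in>UNIV. t ^ (?Q - 1 - q ^ l) * t ^ (q ^ i)) = (if i = l then -1 else 0 :: 'a)"
    if i: "i < n" for i
  proof (cases "i = l")
    case True
    have "?Q - 1 - q ^ l + q ^ l = ?Q - 1" using less[OF l] by simp
    then show ?thesis
      using True sum_power_CARD_minus_1[where 'a = 'a] by (simp flip: power_add)
  next
    case False
    have pos: "q ^ i > 0" "q ^ l > 0" using q_gt_1 by auto
    let ?d = "?Q - 1 - q ^ l + q ^ i"
    have "q ^ i \<noteq> q ^ l" using False q_gt_1 by (simp add: power_inject_exp)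
    then have "?d \<noteq> ?Q - 1" using less[OF l] by linarith
    moreover have "0 < ?d" "?d < 2 * (?Q - 1)"
      using less[OF l] less[OF i] pos by linarith+
    ultimately have "\<not> (?Q - 1) dvd ?d"
    proof (intro notI)
      assume "(?Q - 1) dvd ?d"
      then obtain z where z: "?d = (?Q - 1) * z" by (rule dvdE)
      then have "(?Q - 1) * z < (?Q - 1) * 2" using \<open>?d < 2 * (?Q - 1)\<close> by linarith
      then have "z = 0 \<or> z = 1" by auto
      then show False using z \<open>?d \<noteq> ?Q - 1\<close> \<open>0 < ?d\<close> by (metis mult_0_right mult_1_right less_irrefl)
    qed
    then have "(\<Sum>t\<in>UNIV. t ^ ?d) = (0 :: 'a)" by (rule sum_powers_eq_0)
    with False show ?thesis by (simp add: power_add)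
  qed
  have "(\<Sum>t\<in>UNIV. scale_via id (t ^ (?Q - 1 - q ^ l)) (qeval n g t)) j = - g l j" for j
  proof -
    have "(\<Sum>t\<in>A. F t) j = (\<Sum>t\<in>A. F t j)" for A and F :: "'a \<Rightarrow> nat \<Rightarrow> 'a"
      by (induction A rule: infinite_finite_induct) auto
    then have "(\<Sum>t\<in>UNIV. scale_via id (t ^ (?Q - 1 - q ^ l)) (qeval n g t)) j =
          (\<Sum>t\<in>UNIV. \<Sum>i<n. g i j * (t ^ (?Q - 1 - q ^ l) * t ^ (q ^ i)))"
      by (simp add: scale_via_def qeval_def sum_distrib_left mult_ac)
    also have "\<dots> = (\<Sum>i<n. g i j * (\<Sum>t\<in>UNIV. t ^ (?Q - 1 - q ^ l) * t ^ (q ^ i)))"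
      by (subst sum.swap) (simp add: sum_distrib_left)
    also have "\<dots> = (\<Sum>i<n. if i = l then - g l j else 0)"
      by (intro sum.cong refl, subst ortho) auto
    also have "\<dots> = - g l j" using l by simp
    finally show ?thesis .
  qed
  then have "g l = - (\<Sum>t\<in>UNIV. scale_via id (t ^ (?Q - 1 - q ^ l)) (qeval n g t))"
    by (simp add: fun_eq_iff)
  also have "\<dots> \<in> H"
    by (intro ext.subspace_neg ext.subspace_sum ext.subspace_scale H g)
  finally show ?thesis .
qed

text \<open>The power \<open>q ^ s\<close> shifts coefficients up by \<open>s\<close> and twists
  them. With \<open>K + s \<le> n\<close> the result stays below \<open>q\<close>-degree
  \<open>n\<close>, so no reduction by \<open>t ^ (q ^ n) = t\<close> occurs.\<close>

lemma qeval_frobenius: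
  assumes "K + s \<le> n" "\<And>k. k \<ge> K \<Longrightarrow> a k = 0"
  shows "(\<Sum>k<K. a k * t ^ (q ^ k)) ^ (q ^ s) =
         (\<Sum>l<n. (if s \<le> l then a (l - s) ^ (q ^ s) else 0) * (t :: 'a) ^ (q ^ l))"
proof -
  have "(\<Sum>k<K. a k * t ^ (q ^ k)) ^ (q ^ s) = (\<Sum>k<K. a k ^ (q ^ s) * t ^ (q ^ (k + s)))"
    by (simp add: frobenius_sum power_mult_distrib power_add flip: power_mult)
  also have "\<dots> = (\<Sum>l\<in>{s..<K + s}. a (l - s) ^ (q ^ s) * t ^ (q ^ l))"
    by (rule sum.reindex_bij_witness[of _ "\<lambda>l. l - s" "\<lambda>k. k + s"]) auto
  also have "\<dots> = (\<Sum>l<n. (if s \<le> l then a (l - s) ^ (q ^ s) else 0) * t ^ (q ^ l))"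
    using assms q_gt_1 by (intro sum.mono_neutral_cong_left) auto
  finally show ?thesis .
qed

end

section \<open>The subspace \<open>U_space\<close>\<close>

definition graph_vec :: "nat \<Rightarrow> nat \<Rightarrow> nat \<Rightarrow> nat \<Rightarrow> (nat \<Rightarrow> 'a::field) \<Rightarrow> (nat \<Rightarrow> 'a) \<Rightarrow> nat \<Rightarrow> 'a" where
  "graph_vec q I J m \<alpha> x =
     (\<lambda>j. if j \<in> {1..m} then x j
          else if j \<in> {m+1..2*m} then f_poly q I J m \<alpha> (j - m) x
          else 0)"

lemma U_space_eq_image: "U_space q I J m \<alpha> = graph_vec q I J m \<alpha> ` coord_space m"
  by (auto simp: U_space_def graph_vec_def)

text \<open>Every coordinate thus occurs under the power \<open>q ^ J\<close> in some
  \<open>f_poly\<close>, which later makes the top coefficient injective.\<close>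

lemma cyc_succ_surj:
  assumes "j \<in> {1..m}"
  obtains i where "i \<in> {1..m}" "cyc_succ m i = j"
proof (cases "j = 1")
  case True
  then show ?thesis using assms by (intro that[of m]) (auto simp: cyc_succ_def)
next
  case False
  then show ?thesis using assms by (intro that[of "j - 1"]) (auto simp: cyc_succ_def)
qed

context finite_field_extension
begin

lemma graph_vec_add:
  "graph_vec q I J m \<alpha> (x + y) = graph_vec q I J m \<alpha> x + (graph_vec q I J m \<alpha> y :: nat \<Rightarrow> 'a)"
  by (auto simp: graph_vec_def f_poly_def fun_eq_iff frobenius_add algebra_simps)

lemma graph_vec_scale:
  "graph_vec q I J m \<alpha> (scale_via e c x) = scale_via e c (graph_vec q I J m \<alpha> x)"
  by (auto simp: graph_vec_def f_poly_def fun_eq_iff scale_via_def power_mult_distrib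
      frobenius_embedding algebra_simps)

lemma graph_vec_0: "graph_vec q I J m \<alpha> 0 = (0 :: nat \<Rightarrow> 'a)"
  using graph_vec_add[of I J m \<alpha> 0 0] by simp

lemma subspace_coord_space: "base.subspace (coord_space m)"
  by (rule base.subspaceI) (auto simp: coord_space_def scale_via_def)

lemma subspace_U_space: "base.subspace (U_space q I J m \<alpha>)"
  unfolding U_space_eq_image
proof (rule base.subspaceI)
  let ?G = "graph_vec q I J m \<alpha>"
  show "0 \<in> ?G ` coord_space m"
    using graph_vec_0 zero_in_coord_space by (metis imageI)
  show "u + w \<in> ?G ` coord_space m" if "u \<in> ?G ` coord_space m" "w \<in> ?G ` coord_space m" for u w
    using that graph_vec_add coord_space_add by (smt (verit, best) imageE imageI)
  show "scale_via e c u \<in> ?G ` coord_space m" if "u \<in> ?G ` coord_space m" for c u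
    using that base.subspace_scale[OF subspace_coord_space]
    by (auto simp flip: graph_vec_scale)
qed

text \<open>Coefficient of \<open>t ^ (q ^ l)\<close> in the parametrized point. The guards supply
  zeros where truncated subtraction would return index 0.\<close>

definition graph_coeffs ::
  "nat \<Rightarrow> nat \<Rightarrow> nat \<Rightarrow> (nat \<Rightarrow> 'a) \<Rightarrow> (nat \<Rightarrow> nat \<Rightarrow> 'a) \<Rightarrow> nat \<Rightarrow> nat \<Rightarrow> 'a" where
  "graph_coeffs I J m \<alpha> v l = (\<lambda>j.
     if j \<in> {1..m} then v l j
     else if j \<in> {m+1..2*m} then
       (if I \<le> l then v (l - I) (j - m) ^ (q ^ I) else 0) +
       \<alpha> (cyc_succ m (j - m)) *
         (if J \<le> l then v (l - J) (cyc_succ m (j - m)) ^ (q ^ J) else 0)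
     else 0)"

lemma graph_vec_qeval:
  assumes "I \<le> J" "J \<le> n" and v: "\<And>k. k \<ge> n - J \<Longrightarrow> v k = 0"
  shows "graph_vec q I J m \<alpha> (qeval (n - J) v t) = qeval n (graph_coeffs I J m \<alpha> v) t"
proof
  fix j
  \<comment> \<open>Applied with \<open>s\<close> equal to \<open>I\<close> and \<open>J\<close>,
    and to 0 for the first \<open>m\<close> coordinates.\<close>
  have *: "(qeval (n - J) v t i) ^ (q ^ s) =
      (\<Sum>l<n. (if s \<le> l then v (l - s) i ^ (q ^ s) else 0) * t ^ (q ^ l))"
    if "s \<le> J" for s i
    unfolding qeval_def using that assms by (intro qeval_frobenius) auto
  have 0: "qeval (n - J) v t i = (\<Sum>l<n. v l i * t ^ (q ^ l))" for i
    using *[of 0 i] by simp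
  consider "j \<in> {1..m}" | "j \<in> {m+1..2*m}" | "j \<notin> {1..2*m}" by fastforce
  then show "graph_vec q I J m \<alpha> (qeval (n - J) v t) j = qeval n (graph_coeffs I J m \<alpha> v) t j"
  proof cases
    case 1
    then show ?thesis
      by (simp add: graph_vec_def 0) (simp add: graph_coeffs_def qeval_def)
  next
    case 2
    then have "j \<notin> {1..m}" by auto
    with 2 have "graph_vec q I J m \<alpha> (qeval (n - J) v t) j =
        (\<Sum>l<n. (if I \<le> l then v (l - I) (j - m) ^ (q ^ I) else 0) * t ^ (q ^ l)) +
        \<alpha> (cyc_succ m (j - m)) * (\<Sum>l<n. (if J \<le> l then v (l - J) (cyc_succ m (j - m)) ^ (q ^ J)
          else 0) * t ^ (q ^ l))"
      using assms(1) by (simp only: graph_vec_def f_poly_def * order_refl if_True if_False)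
    also have "\<dots> = (\<Sum>l<n. graph_coeffs I J m \<alpha> v l j * t ^ (q ^ l))"
      using 2 \<open>j \<notin> {1..m}\<close> unfolding sum_distrib_left sum.distrib[symmetric]
      by (intro sum.cong refl) (simp only: graph_coeffs_def if_True if_False distrib_right mult.assoc)
    finally show ?thesis by (simp add: qeval_def)
  next
    case 3
    then show ?thesis by (auto simp: graph_vec_def graph_coeffs_def qeval_def)
  qed
qed

lemma dim_U_space_inter_le:
  assumes IJ: "I < J" "J < n" and \<alpha>: "\<forall>i\<in>{1..m}. \<alpha> i \<noteq> 0"
    and H: "H \<subseteq> coord_space (2 * m)" "ext.subspace H"
  obtains a b where "a + b \<le> ext.dim H"
    "base.dim (U_space q I J m \<alpha> \<inter> H) \<le> a * (n - J) + m * J"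
    "base.dim (U_space q I J m \<alpha> \<inter> H) \<le> b * (n - J) + m * J"
proof -
  let ?G = "graph_vec q I J m \<alpha>" and ?Q = "CARD('a)"
  define T where "T = {x \<in> coord_space m. ?G x \<in> H}"
  define D where "D = base.dim (U_space q I J m \<alpha> \<inter> H)"
  have Q: "?Q > 1" by (rule CARD_field_gt_1)
  have H_base: "base.subspace H"
    using H(2) by (auto simp: base.subspace_def ext.subspace_def scale_via_def)
  have T: "base.subspace T"
    using H_base subspace_coord_space[of m] unfolding T_def base.subspace_def
    by (auto simp: graph_vec_add graph_vec_scale graph_vec_0)
  have T_coord: "T \<subseteq> coord_space m" by (auto simp: T_def)
  have finH: "finite H" using H(1) finite_coord_space finite_subset by blast
  have "inj_on ?G (coord_space m)"
  proof (rule inj_onI, rule ext)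
    fix x y j assume xy: "x \<in> coord_space m" "y \<in> coord_space m" "?G x = ?G y"
    show "x j = y j"
    proof (cases "j \<in> {1..m}")
      case True
      then show ?thesis using fun_cong[OF xy(3), of j] by (simp add: graph_vec_def)
    next
      case False
      then show ?thesis using xy by (simp add: coord_space_def)
    qed
  qed
  moreover have "U_space q I J m \<alpha> \<inter> H = ?G ` T"
    by (auto simp: U_space_eq_image T_def)
  ultimately have "card T = card (U_space q I J m \<alpha> \<inter> H)"
    using card_image[of ?G T] inj_on_subset T_coord by metis
  also have "\<dots> = CARD('k) ^ D"
    unfolding D_def using finH
    by (intro base.card_subspace_eq_power_dim base.subspace_inter subspace_U_space H_base) auto
  \<comment> \<open>The \<open>n\<close>-th power turns base dimension into an exponent of
    \<open>?Q = q ^ n\<close>.\<close>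
  finally have "card T ^ n = ?Q ^ D"
    by (simp add: CARD_base CARD_ext mult.commute flip: power_mult)
  then have lower: "?Q ^ D \<le> card (qmaps m (n - J) T) * ?Q ^ (m * J)"
    using card_subspace_power_le_card_qmaps[OF T T_coord, of "n - J"] IJ by simp
  define A where "A = (\<lambda>v. v (n - J - 1)) ` qmaps m (n - J) T"
  define B where "B = (\<lambda>v. v 0) ` qmaps m (n - J) T"
  have "(\<lambda>v. v i) ` qmaps m (n - J) T \<subseteq> coord_space m" for i
    by (auto simp: qmaps_def)
  then have A: "ext.subspace A" "finite A" "A \<subseteq> coord_space m"
    and B: "ext.subspace B" "finite B" "B \<subseteq> coord_space m"
    unfolding A_def B_def using subspace_qmaps_coeffs[OF T] finite_qmaps by simp_all
  have cardA: "card A = ?Q ^ ext.dim A" and cardB: "card B = ?Q ^ ext.dim B"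
    using A B by (auto intro!: ext.card_subspace_eq_power_dim)
  have coeffs_in_H: "graph_coeffs I J m \<alpha> v l \<in> H" if v: "v \<in> qmaps m (n - J) T" "l < n" for v l
  proof (rule coeff_in_subspace[OF H(2)])
    fix t
    have "qeval n (graph_coeffs I J m \<alpha> v) t = ?G (qeval (n - J) v t)"
      using v IJ by (intro graph_vec_qeval[symmetric]) (auto simp: qmaps_def)
    then show "qeval n (graph_coeffs I J m \<alpha> v) t \<in> H"
      using v by (simp add: qmaps_def T_def)
  qed fact
  define top where "top a = (\<lambda>j. if j \<in> {m+1..2*m} then
      \<alpha> (cyc_succ m (j - m)) * a (cyc_succ m (j - m)) ^ (q ^ J) else 0)" for a :: "nat \<Rightarrow> 'a"
  \<comment> \<open>At degree 0 the term with \<open>q ^ I\<close> contributes only if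
    \<open>I = 0\<close>; the term with \<open>q ^ J\<close> never does, as
    \<open>J > 0\<close>.\<close>
  define bot where "bot b = (\<lambda>j. if j \<in> {1..m} then b j else
      if j \<in> {m+1..2*m} \<and> I = 0 then b (j - m) else 0)" for b :: "nat \<Rightarrow> 'a"
  have top: "top a \<in> H" if a: "a \<in> A" for a
  proof -
    obtain v where v: "v \<in> qmaps m (n - J) T" "a = v (n - J - 1)"
      using a by (auto simp: A_def)
    \<comment> \<open>At degree \<open>n - 1\<close> only the term with \<open>q ^ J\<close>
      survives, since \<open>I < J\<close> pushes the other indices beyond the degree bound of
      \<open>v\<close>.\<close>
    have "n - 1 \<ge> n - J" "n - 1 - I \<ge> n - J" using IJ by auto
    then have "v (n - 1) = 0" "v (n - 1 - I) = 0" using v(1) by (auto simp: qmaps_def)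
    moreover have "I \<le> n - 1" "J \<le> n - 1" "n - 1 - J = n - J - 1" using IJ by auto
    ultimately have "graph_coeffs I J m \<alpha> v (n - 1) = top a"
      using q_gt_1 unfolding graph_coeffs_def top_def v(2) by (intro ext) (auto simp: power_0_left)
    then show ?thesis using coeffs_in_H[OF v(1), of "n - 1"] n_pos by simp
  qed
  have bot: "bot b \<in> H" if b: "b \<in> B" for b
  proof -
    obtain v where v: "v \<in> qmaps m (n - J) T" "b = v 0"
      using b by (auto simp: B_def)
    have "graph_coeffs I J m \<alpha> v 0 = bot b"
      using IJ unfolding graph_coeffs_def bot_def v(2) by (intro ext) auto
    then show ?thesis using coeffs_in_H[OF v(1), of 0] n_pos by simp
  qed
  \<comment> \<open>The first \<open>m\<close> coordinates of \<open>top a + bot b\<close> return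
    \<open>b\<close>. Cancelling \<open>bot b\<close> then recovers \<open>a\<close>, as the entries
    of \<open>\<alpha>\<close> are nonzero and Frobenius powers are injective.\<close>
  have "card (A \<times> B) \<le> card H"
  proof (rule card_inj_on_le[where f = "\<lambda>(a, b). top a + bot b"])
    show "inj_on (\<lambda>(a, b). top a + bot b) (A \<times> B)"
    proof (rule inj_onI, clarify)
      fix a b a' b' assume ab: "a \<in> A" "b \<in> B" "a' \<in> A" "b' \<in> B"
        and eq: "top a + bot b = top a' + bot b'"
      have "b j = b' j" for j
      proof (cases "j \<in> {1..m}")
        case True
        then show ?thesis using fun_cong[OF eq, of j] by (simp add: top_def bot_def)
      next
        case False
        moreover have "b \<in> coord_space m" "b' \<in> coord_space m" using ab B(3) by auto
        ultimately show ?thesis by (simp add: coord_space_def)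
      qed
      then have b: "b = b'" by blast
      have "a j = a' j" for j
      proof (cases "j \<in> {1..m}")
        case True
        then obtain i where i: "i \<in> {1..m}" "cyc_succ m i = j" by (rule cyc_succ_surj)
        have "top a (m + i) = top a' (m + i)" using eq b by simp
        then show ?thesis
          using i True \<alpha> by (auto simp: top_def frobenius_eq_iff)
      next
        case False
        moreover have "a \<in> coord_space m" "a' \<in> coord_space m" using ab A(3) by auto
        ultimately show ?thesis by (simp add: coord_space_def)
      qed
      then show "a = a' \<and> b = b'" using b by blast
    qed
    show "(\<lambda>(a, b). top a + bot b) ` (A \<times> B) \<subseteq> H"
      using top bot ext.subspace_add[OF H(2)] by auto
  qed (rule finH)
  also have "card H = ?Q ^ ext.dim H"
    by (rule ext.card_subspace_eq_power_dim) (use H finH in auto)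
  finally have "?Q ^ (ext.dim A + ext.dim B) \<le> ?Q ^ ext.dim H"
    by (simp add: card_cartesian_product cardA cardB power_add)
  then have "ext.dim A + ext.dim B \<le> ext.dim H"
    by (rule power_le_imp_le_exp[OF Q])
  \<comment> \<open>Comparison of exponents of \<open>?Q\<close>; \<open>c\<close> will be the
    dimension of \<open>A\<close> and of \<open>B\<close>.\<close>
  moreover have "D \<le> c * (n - J) + m * J" if "card (qmaps m (n - J) T) \<le> (?Q ^ c) ^ (n - J)" for c
  proof -
    note lower
    also have "card (qmaps m (n - J) T) * ?Q ^ (m * J) \<le> (?Q ^ c) ^ (n - J) * ?Q ^ (m * J)"
      using that by (rule mult_right_mono) simp
    also have "\<dots> = ?Q ^ (c * (n - J) + m * J)"
      by (simp add: power_add power_mult)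
    finally show ?thesis by (rule power_le_imp_le_exp[OF Q])
  qed
  moreover have "card (qmaps m (n - J) T) \<le> card A ^ (n - J)"
    using card_qmaps_le_top_coeffs[OF T, of "n - J" "n - J - 1" m] IJ by (simp add: A_def Suc_diff_Suc)
  moreover have "card (qmaps m (n - J) T) \<le> card B ^ (n - J)"
    unfolding B_def by (rule card_qmaps_le_bottom_coeffs[OF T]) simp
  ultimately show ?thesis
    unfolding cardA cardB D_def by (intro that[of "ext.dim A" "ext.dim B"]) blast+
qed

end

theorem mainTheorem4:
  fixes e :: "'k::{field,finite} \<Rightarrow> 'a::{field,finite}"
    and q n m I J :: nat
    and \<alpha> :: "nat \<Rightarrow> 'a"
  assumes "primepow q" and "n > 0" and "m \<ge> 3"
    and "CARD('k) = q" and "CARD('a) = q ^ n" and "field_embedding e"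
    and "I < J" and "J < n"
    and "\<forall>i\<in>{1..m}. \<alpha> i \<noteq> 0"
    and "n \<ge> 2 * (m * J + J + 1)"
  shows "\<forall>r. odd r \<and> 2 \<le> r \<and> r \<le> m \<longrightarrow>
           evasive e (2 * m) r (real r * real n / 2 - 1) (U_space q I J m \<alpha>)"
proof (intro allI impI)
  interpret finite_field_extension e q n
    by unfold_locales (use assms in auto)
  fix r assume r: "odd r \<and> 2 \<le> r \<and> r \<le> m"
  then obtain s where s: "r = 2 * s + 1" by (auto elim: oddE)
  have "real (base.dim (U_space q I J m \<alpha> \<inter> H)) \<le> real r * real n / 2 - 1"
    if H: "H \<subseteq> coord_space (2 * m)" "ext.subspace H" "ext.dim H = r" for H
  proof -
    let ?D = "base.dim (U_space q I J m \<alpha> \<inter> H)"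
    obtain a b where ab: "a + b \<le> ext.dim H"
        "?D \<le> a * (n - J) + m * J" "?D \<le> b * (n - J) + m * J"
      using dim_U_space_inter_le[of I J m \<alpha> H] assms H by auto
    \<comment> \<open>Oddness of \<open>r\<close> enters here: \<open>a + b \<le> 2 * s + 1\<close>
      leaves at most \<open>s\<close> for the smaller one.\<close>
    have "min a b \<le> s" using ab(1) H(3) s by simp
    then have "min a b * (n - J) \<le> s * n" by (intro mult_mono) auto
    moreover have "?D \<le> min a b * (n - J) + m * J" using ab by (auto simp: min_def)
    ultimately have "?D \<le> s * n + m * J" by linarith
    \<comment> \<open>After doubling, the loss \<open>2 * (m * J)\<close> and the 2 coming from
      \<open>- 1\<close> fit into the last \<open>n\<close> of
      \<open>r * n = 2 * s * n + n\<close>.\<close>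
    moreover have "2 * (m * J) + 2 \<le> n" using assms(10) by (simp add: algebra_simps)
    ultimately have "2 * ?D + 2 \<le> r * n" using s by (simp add: algebra_simps)
    then have "real (2 * ?D + 2) \<le> real (r * n)" by (rule of_nat_mono)
    then show ?thesis by simp
  qed
  moreover have "U_space q I J m \<alpha> \<subseteq> coord_space (2 * m)"
    by (auto simp: U_space_def coord_space_def)
  ultimately show "evasive e (2 * m) r (real r * real n / 2 - 1) (U_space q I J m \<alpha>)"
    using subspace_U_space by (simp add: evasive_def)
qed

end
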